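(* Let $A$ be a commutative unital Banach algebra over $\mathbb K$ ($\mathbb K=\mathbb R$ or $\mathbb K=\mathbb C$) with unit element $\mathbf 1$. Suppose that $\mathbf u:=(f_1,\dots,f_n,g)\in U_{n+1}(A)$ is reducible. Then there is an invertible matrix $W\in\mathcal M_{n+1}(A)$ with determinant $\mathbf 1$ and which is a finite product of exponential matrices such that $\mathbf u\,W=\mathbf e_1$. In other words, $\mathbf u\in\mathcal P(U_{n+1}(A))$. Moreover, if $M=W^{-1}$, then $\mathbf u$ is the first row of $M$.
   Context: $U_m(A)$ is the set of tuples $(f_1,\dots,f_m)\in A^m$ for which there is $(x_1,\dots,x_m)\in A^m$ with $\sum_jx_jf_j=\mathbf 1$, with the topology induced by $A^m$. $(f_1,\dots,f_n,g)\in U_{n+1}(A)$ is reducible if there is $(a_1,\dots,a_n)\in A^n$ with $(f_1+a_1g,\dots,f_n+a_ng)\in U_n(A)$. $\mathcal M_m(A)$ is the set of $m\times m$ matrices over $A$; an exponential matrix is a matrix of the form $e^{B}$ with $B\in\mathcal M_m(A)$. $\mathbf e_1=(\mathbf 1,0,\dots,0)\in A^{n+1}$ (a row vector). The principal component $\mathcal P(U_m(A))$ is the connected component of $(\mathbf 1,0,\dots,0)$ in $U_m(A)$, given by $\mathcal P(U_m(A))=\{(\mathbf 1,0,\dots,0)\,e^{M_1}\cdots e^{M_k}:k\in\mathbb N,\ M_j\in\mathcal M_m(A)\}$. *)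

theory Defs
  imports
    "HOL-Analysis.Abstract_Topology_2"
    "HOL-Analysis.Function_Topology"
    "Jordan_Normal_Form.Determinant"
begin

text \<open>
  The algebra \<open>A\<close> is a type of sort \<open>{banach, real_normed_algebra, comm_ring_1}\<close>.  This covers both
  scalar fields: a complex Banach algebra is a real one by restriction of scalars, and none of the
  notions below depends on the scalar field.  The norm is submultiplicative, but
  \<open>norm 1 = 1\<close> is not required.

  Tuples over \<open>A\<close> and square matrices over \<open>A\<close> are vectors and matrices with explicit dimension, so
  that \<open>n\<close> and \<open>n + 1\<close> can occur side by side.  Indices start at 0.
\<close>

definition unimodular :: "nat \<Rightarrow> 'a::comm_ring_1 vec set" where
  "unimodular m = {f \<in> carrier_vec m. \<exists>x \<in> carrier_vec m. scalar_prod x f = 1}"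

text \<open>Tuples carry the product topology of \<open>A\<^sup>m\<close>, transported along the coordinate map.\<close>

definition tuple_topology :: "nat \<Rightarrow> 'a::topological_space vec topology" where
  "tuple_topology m =
     pullback_topology (carrier_vec m) (\<lambda>v. restrict (vec_index v) {..<m})
       (product_topology (\<lambda>_. euclidean) {..<m})"

definition unimodular_topology ::
    "nat \<Rightarrow> 'a::{topological_space, comm_ring_1} vec topology" where
  "unimodular_topology m = subtopology (tuple_topology m) (unimodular m)"

definition principal_component :: "nat \<Rightarrow> 'a::{topological_space, comm_ring_1} vec set" where
  "principal_component m =
     connected_component_of_set (unimodular_topology m) (unit_vec m 0)"

abbreviation snoc_vec :: "'a vec \<Rightarrow> 'a \<Rightarrow> 'a vec" where
  "snoc_vec f g \<equiv> f @\<^sub>v vec_of_list [g]"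

text \<open>For \<open>u = (f\<^sub>1, \<dots>, f\<^sub>n, g)\<close>, the entries \<open>u $ j\<close> with \<open>j < n\<close> are the \<open>f\<close>s and \<open>u $ n\<close> is \<open>g\<close>.\<close>

definition reducible :: "nat \<Rightarrow> 'a::comm_ring_1 vec \<Rightarrow> bool" where
  "reducible n u \<longleftrightarrow> u \<in> unimodular (n + 1) \<and>
     (\<exists>a \<in> carrier_vec n. vec n (\<lambda>j. u $ j + a $ j * u $ n) \<in> unimodular n)"

text \<open>
  The matrix exponential.  The type of matrices has no topology, so the series \<open>\<Sum>k. B\<^sup>k / k!\<close> is
  summed entrywise; for matrices of a fixed size this is convergence in any of the usual
  (equivalent) norms, and the series always converges.
\<close>

definition mat_exp :: "'a::{banach, real_normed_algebra, comm_ring_1} mat \<Rightarrow> 'a mat" where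
  "mat_exp B = mat (dim_row B) (dim_col B)
     (\<lambda>(i, j). \<Sum>k. (B ^\<^sub>m k) $$ (i, j) /\<^sub>R fact k)"

definition exponential_products ::
    "nat \<Rightarrow> 'a::{banach, real_normed_algebra, comm_ring_1} mat set" where
  "exponential_products m =
     {foldr (*) (map mat_exp Bs) (1\<^sub>m m) | Bs. set Bs \<subseteq> carrier_mat m m}"

end

theory Submission
  imports Defs
begin

text \<open>
  If \<open>p \<bullet> q = 0\<close>, then the rank-one matrix \<open>p q\<^sup>T\<close> squares to zero, so that the transvection
  \<open>1 + p q\<^sup>T\<close> is its exponential; on row vectors it acts by \<open>w \<mapsto> w + (p \<bullet> w) q\<close>.
  Let \<open>v = f + a g\<close> with \<open>x \<bullet> v = 1\<close>.  Four transvections, each of which changes only the first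
  \<open>n\<close> entries or only the last one, carry \<open>u\<close> to the first unit vector:
  \<open>(f, g) \<mapsto> (v, g) \<mapsto> (v, g + (1 - g) (x \<bullet> v)) = (v, 1) \<mapsto> (e, 1) \<mapsto> (e, 0)\<close>.
  Scaling \<open>p\<close> by \<open>t \<in> [0, 1]\<close> turns each of these steps into a path of unimodular tuples.
\<close>

section \<open>Transvections: exponentials, determinants and action on rows\<close>

definition transvection :: "nat \<Rightarrow> 'a::comm_ring_1 vec \<Rightarrow> 'a vec \<Rightarrow> 'a mat" where
  "transvection m p q = 1\<^sub>m m + mat m m (\<lambda>(i, j). p $ i * q $ j)"

lemma transvection_carrier [simp]: "transvection m p q \<in> carrier_mat m m"
  by (simp add: transvection_def)

lemma mat_of_row_mult_transvection:
  fixes p q w :: "'a::comm_ring_1 vec"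
  assumes "p \<in> carrier_vec m" "q \<in> carrier_vec m" "w \<in> carrier_vec m"
  shows "mat_of_row w * transvection m p q = mat_of_row (w + (p \<bullet> w) \<cdot>\<^sub>v q)"
proof (rule eq_matI)
  fix i j
  assume "i < dim_row (mat_of_row (w + (p \<bullet> w) \<cdot>\<^sub>v q))" "j < dim_col (mat_of_row (w + (p \<bullet> w) \<cdot>\<^sub>v q))"
  then have i: "i = 0" and j: "j < m" using assms by auto
  have "(mat_of_row w * transvection m p q) $$ (i, j)
      = (\<Sum>k = 0..<m. w $ k * ((if k = j then 1 else 0) + p $ k * q $ j))"
    using i j assms by (auto simp: transvection_def scalar_prod_def intro!: sum.cong)
  also have "\<dots> = (\<Sum>k = 0..<m. (if k = j then w $ k else 0) + p $ k * w $ k * q $ j)"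
    by (rule sum.cong) (auto simp: algebra_simps)
  also have "\<dots> = (\<Sum>k = 0..<m. if k = j then w $ k else 0) + (\<Sum>k = 0..<m. p $ k * w $ k) * q $ j"
    by (simp only: sum.distrib sum_distrib_right)
  also have "\<dots> = w $ j + (p \<bullet> w) * q $ j"
    using j assms by (simp add: scalar_prod_def)
  finally show "(mat_of_row w * transvection m p q) $$ (i, j) = mat_of_row (w + (p \<bullet> w) \<cdot>\<^sub>v q) $$ (i, j)"
    using i j assms by simp
qed (use assms in \<open>auto simp: transvection_def\<close>)

text \<open>All powers of \<open>B\<close> from the second on vanish, so at each entry the
  exponential series has only the terms for the exponents 0 and 1.\<close>

lemma mat_exp_square_zero:
  fixes B :: "'a::{banach, real_normed_algebra, comm_ring_1} mat"
  assumes B: "B \<in> carrier_mat m m" and BB: "B * B = 0\<^sub>m m m"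
  shows "mat_exp B = 1\<^sub>m m + B"
proof (rule eq_matI)
  fix i j
  assume "i < dim_row (1\<^sub>m m + B)" "j < dim_col (1\<^sub>m m + B)"
  then have ij: "i < m" "j < m" using B by auto
  have pow: "B ^\<^sub>m (k + 2) = 0\<^sub>m m m" for k
  proof (induction k)
    case 0
    show ?case using B BB by (simp add: numeral_2_eq_2)
  next
    case (Suc k)
    then show ?case using B by simp
  qed
  have zero: "(B ^\<^sub>m k) $$ (i, j) /\<^sub>R fact k = 0" if "k \<notin> {0, 1}" for k
  proof -
    \<comment> \<open>Here \<open>k\<close> is at least 2, so the subtraction of naturals is not
      truncated.\<close>
    have "k = (k - 2) + 2" using that by (cases k; cases "k - 1") auto
    then have "B ^\<^sub>m k = 0\<^sub>m m m" using pow by metis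
    then show ?thesis using ij by simp
  qed
  have "(\<Sum>k. (B ^\<^sub>m k) $$ (i, j) /\<^sub>R fact k) = (\<Sum>k \<in> {0, 1}. (B ^\<^sub>m k) $$ (i, j) /\<^sub>R fact k)"
    by (rule suminf_finite) (use zero in auto)
  also have "\<dots> = (1\<^sub>m m + B) $$ (i, j)"
    using B ij by simp
  finally show "mat_exp B $$ (i, j) = (1\<^sub>m m + B) $$ (i, j)"
    using B ij by (simp add: mat_exp_def)
qed (use B in \<open>auto simp: mat_exp_def\<close>)

text \<open>The square of p q^T is (p . q) times p q^T, hence zero by orthogonality.\<close>

lemma transvection_eq_mat_exp:
  fixes p q :: "'a::{banach, real_normed_algebra, comm_ring_1} vec"
  assumes "p \<in> carrier_vec m" "q \<in> carrier_vec m" "p \<bullet> q = 0"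
  obtains B where "B \<in> carrier_mat m m" "transvection m p q = mat_exp B"
proof
  let ?B = "mat m m (\<lambda>(i, j). p $ i * q $ j)"
  have "?B * ?B = 0\<^sub>m m m"
  proof (rule eq_matI)
    fix i j
    assume "i < dim_row (0\<^sub>m m m)" "j < dim_col (0\<^sub>m m m)"
    then have ij: "i < m" "j < m" by auto
    have "(?B * ?B) $$ (i, j) = (\<Sum>k = 0..<m. p $ i * q $ k * (p $ k * q $ j))"
      using ij by (simp add: scalar_prod_def)
    also have "\<dots> = p $ i * q $ j * (\<Sum>k = 0..<m. p $ k * q $ k)"
      by (simp add: sum_distrib_left algebra_simps)
    also have "\<dots> = 0" using assms by (simp add: scalar_prod_def)
    finally show "(?B * ?B) $$ (i, j) = 0\<^sub>m m m $$ (i, j)" using ij by simp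
  qed auto
  then show "transvection m p q = mat_exp ?B"
    by (subst mat_exp_square_zero[of _ m]) (auto simp: transvection_def)
qed simp

text \<open>The hypothesis includes \<open>i = j\<close>: the matrix is triangular and its diagonal
  consists of ones. In general the determinant is 1 + p . q; the triangular case is enough because
  \<open>p\<close> and \<open>q\<close> will have complementary supports.\<close>

lemma det_transvection_upper:
  fixes p q :: "'a::comm_ring_1 vec"
  assumes "\<And>i j. j \<le> i \<Longrightarrow> i < m \<Longrightarrow> p $ i * q $ j = 0"
  shows "det (transvection m p q) = 1"
proof -
  have "det (transvection m p q) = prod_list (diag_mat (transvection m p q))"
    by (rule det_upper_triangular[of _ m]) (auto simp: transvection_def assms intro!: upper_triangularI)
  also have "diag_mat (transvection m p q) = map (\<lambda>_. 1) [0..<m]"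
    by (auto simp: diag_mat_def transvection_def assms)
  also have "prod_list \<dots> = 1" by (induction m) auto
  finally show ?thesis .
qed

text \<open>Transposing exchanges \<open>p\<close> and \<open>q\<close>, which reduces this to the
  upper triangular case.\<close>

lemma det_transvection_lower:
  fixes p q :: "'a::comm_ring_1 vec"
  assumes "\<And>i j. i \<le> j \<Longrightarrow> j < m \<Longrightarrow> p $ i * q $ j = 0"
  shows "det (transvection m p q) = 1"
proof -
  have "transpose_mat (transvection m p q) = transvection m q p"
    by (auto simp: transvection_def mult.commute)
  moreover have "det (transvection m q p) = 1"
    by (rule det_transvection_upper) (use assms in \<open>simp add: mult.commute\<close>)
  ultimately show ?thesis
    by (metis det_transpose transvection_carrier)
qed

section \<open>Action on unimodular tuples, and the paths it gives\<close>

lemma unimodular_transvection: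
  fixes p q w :: "'a::comm_ring_1 vec"
  assumes w: "w \<in> unimodular m" and pq: "p \<in> carrier_vec m" "q \<in> carrier_vec m" "p \<bullet> q = 0"
  shows "w + (p \<bullet> w) \<cdot>\<^sub>v q \<in> unimodular m"
proof -
  obtain x where wc: "w \<in> carrier_vec m" and x: "x \<in> carrier_vec m" "x \<bullet> w = 1"
    using w by (auto simp: unimodular_def)
  \<comment> \<open>The witness is (1 - p q^T) x. Since p q^T squares to zero, this is the inverse
    transvection applied to the column \<open>x\<close>, and it cancels the transvection applied to
    \<open>w\<close>.\<close>
  have "(x - (x \<bullet> q) \<cdot>\<^sub>v p) \<bullet> (w + (p \<bullet> w) \<cdot>\<^sub>v q) = 1"
    using wc x pq
    by (simp add: minus_scalar_prod_distrib[where n = m] scalar_prod_add_distrib[where n = m])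
  then show ?thesis
    using wc x pq by (auto simp: unimodular_def intro!: bexI[of _ "x - (x \<bullet> q) \<cdot>\<^sub>v p"])
qed

lemma topspace_unimodular_topology:
  "topspace (unimodular_topology m) = (unimodular m :: 'a::{topological_space, comm_ring_1} vec set)"
  by (auto simp: unimodular_topology_def tuple_topology_def topspace_pullback_topology unimodular_def)

lemma connected_component_transvection:
  fixes p q w :: "'a::{banach, real_normed_algebra, comm_ring_1} vec"
  assumes w: "w \<in> unimodular m" and pq: "p \<in> carrier_vec m" "q \<in> carrier_vec m" "p \<bullet> q = 0"
  shows "connected_component_of (unimodular_topology m) w (w + (p \<bullet> w) \<cdot>\<^sub>v q)"
proof -
  \<comment> \<open>Scaling \<open>p\<close> keeps it orthogonal to \<open>q\<close>, so the whole
    path stays unimodular. Scalars of vectors are ring elements, so the real \<open>t\<close> enters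
    as \<open>t *\<^sub>R 1\<close>.\<close>
  define h where "h t = w + ((t *\<^sub>R 1 \<cdot>\<^sub>v p) \<bullet> w) \<cdot>\<^sub>v q" for t :: real
  have wc: "w \<in> carrier_vec m" using w by (simp add: unimodular_def)
  have h_unimodular: "h t \<in> unimodular m" for t
    unfolding h_def by (rule unimodular_transvection[OF w]) (use pq in auto)
  \<comment> \<open>Each coordinate is affine in \<open>t\<close>, which gives continuity in the
    product topology.\<close>
  have h_index: "h t $ i = w $ i + t *\<^sub>R ((p \<bullet> w) * q $ i)" if "i < m" for t i
    using that wc pq by (simp add: h_def)
  have "continuous_map (top_of_set {0..1}) (tuple_topology m) h"
    unfolding tuple_topology_def
  proof (rule continuous_map_pullback')
    have "continuous_on {0..1} (\<lambda>t. restrict (vec_index (h t)) {..<m} i)" if "i < m" for i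
      using that by (auto simp: h_index intro!: continuous_intros)
    then show "continuous_map (top_of_set {0..1}) (product_topology (\<lambda>_. euclidean) {..<m})
        ((\<lambda>v. restrict (vec_index v) {..<m}) \<circ> h)"
      by (auto simp: continuous_map_componentwise o_def)
    show "topspace (top_of_set {0..1}) \<subseteq> h -` carrier_vec m"
      using h_unimodular by (auto simp: unimodular_def)
  qed
  then have h_cont: "continuous_map (top_of_set {0..1}) (unimodular_topology m) h"
    using h_unimodular by (auto simp: unimodular_topology_def continuous_map_in_subtopology)
  have "connectedin (unimodular_topology m) (h ` {0..1})"
    by (rule connectedin_continuous_map_image[OF h_cont]) (simp add: connectedin_subtopology)
  moreover have "w \<in> h ` {0..1}"
    using wc pq by (intro image_eqI[of _ _ 0]) (auto simp: h_def)
  moreover have "w + (p \<bullet> w) \<cdot>\<^sub>v q \<in> h ` {0..1}"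
    using wc pq by (intro image_eqI[of _ _ 1]) (auto simp: h_def)
  ultimately show ?thesis
    unfolding connected_component_of_def by blast
qed

section \<open>Invertibility, exponential products and the reduction relation\<close>

lemma invertible_mat_det_1:
  fixes W :: "'a::comm_ring_1 mat"
  assumes "W \<in> carrier_mat m m" "det W = 1"
  shows "invertible_mat W"
  \<comment> \<open>When the determinant is 1, the adjugate is a two-sided inverse.\<close>
  using adj_mat[OF assms(1)] assms
  by (auto simp: invertible_mat_def inverts_mat_def intro!: exI[of _ "adj_mat W"])

lemma one_mat_exponential_products: "1\<^sub>m m \<in> exponential_products m"
  by (auto simp: exponential_products_def intro!: exI[of _ "[]"])

lemma mat_exp_mult_exponential_products:
  assumes "W \<in> exponential_products m" "B \<in> carrier_mat m m"
  shows "mat_exp B * W \<in> exponential_products m"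
proof -
  obtain Bs where "W = foldr (*) (map mat_exp Bs) (1\<^sub>m m)" "set Bs \<subseteq> carrier_mat m m"
    using assms(1) by (auto simp: exponential_products_def)
  then show ?thesis
    using assms(2) by (auto simp: exponential_products_def intro!: exI[of _ "B # Bs"])
qed

text \<open>The matrix claim and the topological claim are bundled so that each transvection
  advances both at once.\<close>

definition exp_reduces ::
    "nat \<Rightarrow> 'a::{banach, real_normed_algebra, comm_ring_1} vec \<Rightarrow> 'a vec \<Rightarrow> bool" where
  "exp_reduces m e w \<longleftrightarrow>
     (\<exists>W \<in> carrier_mat m m. det W = 1 \<and> W \<in> exponential_products m \<and>
        mat_of_row w * W = mat_of_row e) \<and>
     connected_component_of (unimodular_topology m) e w"

lemma exp_reduces_refl:
  assumes "e \<in> unimodular m"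
  shows "exp_reduces m e e"
  using assms one_mat_exponential_products[of m]
  by (auto simp: exp_reduces_def connected_component_of_refl topspace_unimodular_topology
      unimodular_def intro!: bexI[of _ "1\<^sub>m m"])

text \<open>The rule works backwards: if \<open>W\<close> reduces the transformed tuple, then the
  transvection times \<open>W\<close> reduces \<open>w\<close>. The new factor comes first because
  rows are multiplied from the right. On the topological side the path from \<open>w\<close> is
  appended.\<close>

lemma exp_reduces_transvection:
  assumes red: "exp_reduces m e (w + (p \<bullet> w) \<cdot>\<^sub>v q)"
    and w: "w \<in> unimodular m" and pq: "p \<in> carrier_vec m" "q \<in> carrier_vec m" "p \<bullet> q = 0"
    and det: "det (transvection m p q) = 1"
  shows "exp_reduces m e w"
proof -
  have wc: "w \<in> carrier_vec m" using w by (simp add: unimodular_def)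
  obtain W where W: "W \<in> carrier_mat m m" "det W = 1" "W \<in> exponential_products m"
    and We: "mat_of_row (w + (p \<bullet> w) \<cdot>\<^sub>v q) * W = mat_of_row e"
    using red by (auto simp: exp_reduces_def)
  let ?T = "transvection m p q"
  obtain B where "B \<in> carrier_mat m m" "?T = mat_exp B"
    using transvection_eq_mat_exp[OF pq] .
  then have "?T * W \<in> exponential_products m"
    using mat_exp_mult_exponential_products[OF W(3)] by simp
  moreover have "det (?T * W) = 1"
    using W det by (simp add: det_mult[of _ m])
  moreover have "mat_of_row w * (?T * W) = mat_of_row e"
    using assoc_mult_mat[of "mat_of_row w" 1 m ?T m W m] wc W We
    by (simp add: mat_of_row_mult_transvection[OF pq(1,2) wc])
  moreover have "connected_component_of (unimodular_topology m) e w"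
    using red connected_component_transvection[OF w pq]
    by (meson exp_reduces_def connected_component_of_sym connected_component_of_trans)
  ultimately show ?thesis
    using W(1) by (auto simp: exp_reduces_def intro!: bexI[of _ "?T * W"] mult_carrier_mat)
qed

section \<open>Tuples with an appended last entry\<close>

declare vec_of_list_Cons [simp del] vec_of_list_index [simp]

lemma scalar_prod_snoc_vec:
  fixes v w :: "'a::comm_ring_1 vec"
  assumes "v \<in> carrier_vec n" "w \<in> carrier_vec n"
  shows "snoc_vec v c \<bullet> snoc_vec w d = v \<bullet> w + c * d"
proof -
  have singleton: "vec_of_list [z] \<in> carrier_vec 1" for z :: 'a
    by (rule carrier_vecI) simp
  have "snoc_vec v c \<bullet> snoc_vec w d = v \<bullet> w + vec_of_list [c] \<bullet> vec_of_list [d]"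
    by (rule scalar_prod_append[OF assms(1) singleton assms(2) singleton])
  also have "vec_of_list [c] \<bullet> vec_of_list [d] = c * d"
    by (simp add: scalar_prod_def)
  finally show ?thesis .
qed

lemma snoc_vec_carrier [simp]:
  "snoc_vec v c \<in> carrier_vec (Suc n) \<longleftrightarrow> v \<in> carrier_vec n"
  unfolding carrier_vec_def by simp

lemma snoc_vec_index:
  assumes "v \<in> carrier_vec n" "i \<le> n"
  shows "snoc_vec v c $ i = (if i < n then v $ i else c)"
proof -
  have "dim_vec v = n" using assms(1) by simp
  moreover have "i < n \<or> i = n" using assms(2) by auto
  ultimately show ?thesis by (elim disjE) simp_all
qed

lemma snoc_vec_add:
  assumes "v \<in> carrier_vec n" "w \<in> carrier_vec n"
  shows "snoc_vec v c + snoc_vec w d = snoc_vec (v + w) (c + d)"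
proof (rule eq_vecI)
  fix i
  assume "i < dim_vec (snoc_vec (v + w) (c + d))"
  then have "i < n \<or> i = n" using assms by auto
  then show "(snoc_vec v c + snoc_vec w d) $ i = snoc_vec (v + w) (c + d) $ i"
    by (elim disjE) (use assms in simp_all)
qed (use assms in simp)

lemma snoc_vec_smult: "k \<cdot>\<^sub>v snoc_vec v c = snoc_vec (k \<cdot>\<^sub>v v) (k * c)"
proof (rule eq_vecI)
  fix i
  assume "i < dim_vec (snoc_vec (k \<cdot>\<^sub>v v) (k * c))"
  then have "i < dim_vec v \<or> i = dim_vec v" by auto
  then show "(k \<cdot>\<^sub>v snoc_vec v c) $ i = snoc_vec (k \<cdot>\<^sub>v v) (k * c) $ i"
    by (elim disjE) simp_all
qed simp

section \<open>The two kinds of elementary step and their composition\<close>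

lemma exp_reduces_init:
  fixes v a :: "'a::{banach, real_normed_algebra, comm_ring_1} vec"
  assumes v: "v \<in> carrier_vec n" and a: "a \<in> carrier_vec n"
    and w: "snoc_vec v c \<in> unimodular (Suc n)"
    and red: "exp_reduces (Suc n) e (snoc_vec (v + c \<cdot>\<^sub>v a) c)"
  shows "exp_reduces (Suc n) e (snoc_vec v c)"
\<comment> \<open>This \<open>p\<close> reads off the last entry \<open>c\<close>, and
  \<open>q\<close> adds the multiple of \<open>a\<close> to the first \<open>n\<close> entries only.
  The off-diagonal entries fill the last row, so the matrix is lower triangular.\<close>
proof (rule exp_reduces_transvection[where p = "snoc_vec (0\<^sub>v n) 1" and q = "snoc_vec a 0", OF _ w])
  have "snoc_vec v c + (snoc_vec (0\<^sub>v n) 1 \<bullet> snoc_vec v c) \<cdot>\<^sub>v snoc_vec a 0 = snoc_vec (v + c \<cdot>\<^sub>v a) c"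
    using v a by (auto simp: scalar_prod_snoc_vec[of _ n] snoc_vec_add snoc_vec_smult)
  then show "exp_reduces (Suc n) e
      (snoc_vec v c + (snoc_vec (0\<^sub>v n) 1 \<bullet> snoc_vec v c) \<cdot>\<^sub>v snoc_vec a 0)"
    using red by simp
  show "det (transvection (Suc n) (snoc_vec (0\<^sub>v n) 1) (snoc_vec a 0)) = 1"
    by (rule det_transvection_lower) (use a in \<open>auto simp: snoc_vec_index[where n = n]\<close>)
qed (use a in \<open>auto simp: scalar_prod_snoc_vec[of _ n]\<close>)

lemma exp_reduces_last:
  fixes v x :: "'a::{banach, real_normed_algebra, comm_ring_1} vec"
  assumes v: "v \<in> carrier_vec n" and x: "x \<in> carrier_vec n"
    and w: "snoc_vec v c \<in> unimodular (Suc n)"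
    and red: "exp_reduces (Suc n) e (snoc_vec v (c + x \<bullet> v))"
  shows "exp_reduces (Suc n) e (snoc_vec v c)"
\<comment> \<open>Now \<open>p\<close> pairs \<open>x\<close> with the first \<open>n\<close>
  entries and \<open>q\<close> is the last unit vector. The off-diagonal entries fill the last
  column, so the matrix is upper triangular.\<close>
proof (rule exp_reduces_transvection[where p = "snoc_vec x 0" and q = "snoc_vec (0\<^sub>v n) 1", OF _ w])
  have "snoc_vec v c + (snoc_vec x 0 \<bullet> snoc_vec v c) \<cdot>\<^sub>v snoc_vec (0\<^sub>v n) 1 = snoc_vec v (c + x \<bullet> v)"
    using v x by (auto simp: scalar_prod_snoc_vec[of _ n] snoc_vec_add snoc_vec_smult)
  then show "exp_reduces (Suc n) e
      (snoc_vec v c + (snoc_vec x 0 \<bullet> snoc_vec v c) \<cdot>\<^sub>v snoc_vec (0\<^sub>v n) 1)"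
    using red by simp
  show "det (transvection (Suc n) (snoc_vec x 0) (snoc_vec (0\<^sub>v n) 1)) = 1"
    by (rule det_transvection_upper) (use x in \<open>auto simp: snoc_vec_index[where n = n]\<close>)
qed (use x in \<open>auto simp: scalar_prod_snoc_vec[of _ n]\<close>)

lemma unimodular_snoc_vec:
  assumes "v \<in> carrier_vec n" "y \<in> carrier_vec n" "y \<bullet> v + d * c = 1"
  shows "snoc_vec v c \<in> unimodular (Suc n)"
proof -
  have "snoc_vec y d \<bullet> snoc_vec v c = 1"
    using assms(3) by (simp only: scalar_prod_snoc_vec[OF assms(2,1)])
  moreover have "snoc_vec y d \<in> carrier_vec (Suc n)" "snoc_vec v c \<in> carrier_vec (Suc n)"
    using assms(1,2) by simp_all
  ultimately show ?thesis
    unfolding unimodular_def by blast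
qed

lemma reducible_imp_exp_reduces:
  fixes f :: "'a::{banach, real_normed_algebra, comm_ring_1} vec"
  assumes f: "f \<in> carrier_vec n" and red: "reducible n (snoc_vec f g)"
  shows "exp_reduces (Suc n) (unit_vec (Suc n) 0) (snoc_vec f g)"
proof -
  obtain a where a: "a \<in> carrier_vec n"
    and "vec n (\<lambda>j. snoc_vec f g $ j + a $ j * snoc_vec f g $ n) \<in> unimodular n"
    using red unfolding reducible_def by blast
  moreover define v where "v = f + g \<cdot>\<^sub>v a"
  moreover have "vec n (\<lambda>j. snoc_vec f g $ j + a $ j * snoc_vec f g $ n) = f + g \<cdot>\<^sub>v a"
    using f a by (intro eq_vecI) (auto simp: snoc_vec_index[OF f] mult.commute)
  ultimately have "v \<in> unimodular n"
    by simp
  then obtain x where x: "x \<in> carrier_vec n" "x \<bullet> v = 1"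
    unfolding unimodular_def by blast
  have v: "v \<in> carrier_vec n" using f a by (simp add: v_def)
  \<comment> \<open>For \<open>n = 0\<close> the pairing of \<open>x\<close> with \<open>v\<close>
    would be an empty sum, but 0 and 1 differ in the ring. So the first unit vector of length
    \<open>n\<close> really has an entry 1.\<close>
  have "n > 0" using x v by (cases n) (auto simp: scalar_prod_def)
  define e :: "'a vec" where "e = unit_vec n 0"
  have e: "e \<in> carrier_vec n" "e \<bullet> e = 1"
    using \<open>n > 0\<close> by (auto simp: e_def)
  have "unit_vec (Suc n) 0 = snoc_vec e 0"
    using \<open>n > 0\<close> by (intro eq_vecI) (auto simp: e_def less_Suc_eq)
  moreover have "exp_reduces (Suc n) (snoc_vec e 0) (snoc_vec f g)"
  \<comment> \<open>The step rules pass from the new tuple back to the old one, so the stages are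
    nested: the outermost is the first move, the innermost the last.\<close>
  proof (rule exp_reduces_init[OF f a])
    show "snoc_vec f g \<in> unimodular (Suc n)" using red by (simp add: reducible_def)
    have "exp_reduces (Suc n) (snoc_vec e 0) (snoc_vec v g)"
    proof (rule exp_reduces_last[OF v])
      \<comment> \<open>As \<open>x\<close> pairs with \<open>v\<close> to 1, this choice adds
        exactly 1 - g to the last entry and makes it 1.\<close>
      show "(1 - g) \<cdot>\<^sub>v x \<in> carrier_vec n" using x by simp
      show "snoc_vec v g \<in> unimodular (Suc n)"
        \<comment> \<open>Coefficient 0 on the last entry: \<open>v\<close> is already
          unimodular.\<close>
        by (rule unimodular_snoc_vec[OF v x(1), of 0]) (simp add: x)
      have "exp_reduces (Suc n) (snoc_vec e 0) (snoc_vec v 1)"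
      proof (rule exp_reduces_init[OF v])
        \<comment> \<open>With 1 in the last place, any vector can be added to the first
          \<open>n\<close> entries, in particular the difference to the target.\<close>
        show "e - v \<in> carrier_vec n" using e v by simp
        show "snoc_vec v 1 \<in> unimodular (Suc n)"
          by (rule unimodular_snoc_vec[OF v x(1), of 0]) (simp add: x)
        have "exp_reduces (Suc n) (snoc_vec e 0) (snoc_vec e 1)"
        proof (rule exp_reduces_last[OF e(1)])
          \<comment> \<open>Pairing \<open>- e\<close> with \<open>e\<close> gives -1, which cancels
            the last entry 1.\<close>
          show "- e \<in> carrier_vec n" using e by simp
          show "snoc_vec e 1 \<in> unimodular (Suc n)"
            by (rule unimodular_snoc_vec[OF e(1) e(1), of 0]) (simp add: e)
          have "snoc_vec e 0 \<in> unimodular (Suc n)"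
            by (rule unimodular_snoc_vec[OF e(1) e(1), of 0]) (simp add: e)
          then show "exp_reduces (Suc n) (snoc_vec e 0) (snoc_vec e (1 + (- e) \<bullet> e))"
            using exp_reduces_refl e by simp
        qed
        moreover have "v + 1 \<cdot>\<^sub>v (e - v) = e" using e v by auto
        ultimately show "exp_reduces (Suc n) (snoc_vec e 0) (snoc_vec (v + 1 \<cdot>\<^sub>v (e - v)) 1)"
          by simp
      qed
      then show "exp_reduces (Suc n) (snoc_vec e 0) (snoc_vec v (g + ((1 - g) \<cdot>\<^sub>v x) \<bullet> v))"
        using x v by simp
    qed
    then show "exp_reduces (Suc n) (snoc_vec e 0) (snoc_vec (f + g \<cdot>\<^sub>v a) g)"
      by (simp add: v_def)
  qed
  ultimately show ?thesis by simp
qed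

section \<open>The first row of the inverse, and the conclusion\<close>

lemma row_inverse:
  fixes W M :: "'a::comm_ring_1 mat"
  assumes u: "u \<in> carrier_vec m" and e: "e \<in> carrier_vec m"
    and W: "W \<in> carrier_mat m m" and M: "M \<in> carrier_mat m m"
    and uW: "mat_of_row u * W = mat_of_row e" and inv: "inverts_mat W M"
  shows "mat_of_row e * M = mat_of_row u"
proof -
  have "mat_of_row e * M = mat_of_row u * (W * M)"
    using assoc_mult_mat[of "mat_of_row u" 1 m W m M m] u W M uW by simp
  also have "\<dots> = mat_of_row u"
    using u W inv by (simp add: inverts_mat_def)
  finally show ?thesis .
qed

lemma mat_of_row_unit_vec_mult:
  fixes M :: "'a::comm_ring_1 mat"
  assumes "M \<in> carrier_mat m m" "i < m"
  shows "mat_of_row (unit_vec m i) * M = mat_of_row (row M i)"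
  using assms by (intro eq_matI) (auto simp: scalar_prod_left_unit)

theorem theorem3p1:
  fixes f :: "'a::{banach, real_normed_algebra, comm_ring_1} vec"
    and g :: 'a and n :: nat and u :: "'a vec"
  assumes "f \<in> carrier_vec n"
    and "u = snoc_vec f g"
    and "u \<in> unimodular (n + 1)"
    and "reducible n u"
  shows "(\<exists>W \<in> carrier_mat (n + 1) (n + 1).
            invertible_mat W \<and> det W = 1 \<and> W \<in> exponential_products (n + 1) \<and>
            mat_of_row u * W = mat_of_row (unit_vec (n + 1) 0) \<and>
            (\<forall>M \<in> carrier_mat (n + 1) (n + 1).
               inverts_mat W M \<and> inverts_mat M W \<longrightarrow> row M 0 = u)) \<and>
         u \<in> principal_component (n + 1)"
proof -
  have u: "u \<in> carrier_vec (n + 1)" using assms(3) by (simp add: unimodular_def)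
  have red: "exp_reduces (n + 1) (unit_vec (n + 1) 0) u"
    using reducible_imp_exp_reduces[OF assms(1)] assms(2,4) by simp
  then obtain W where W: "W \<in> carrier_mat (n + 1) (n + 1)" "det W = 1"
      "W \<in> exponential_products (n + 1)" "mat_of_row u * W = mat_of_row (unit_vec (n + 1) 0)"
    by (auto simp: exp_reduces_def)
  have "row M 0 = u" if M: "M \<in> carrier_mat (n + 1) (n + 1)" "inverts_mat W M" for M
  proof -
    have "mat_of_row (row M 0) = mat_of_row u"
      \<comment> \<open>Multiplying u W = e_1 by \<open>M\<close> on the right gives u = e_1 M, and
        this product is row 0 of \<open>M\<close>.\<close>
      using row_inverse[OF u unit_vec_carrier W(1) M(1) W(4) M(2)] mat_of_row_unit_vec_mult[OF M(1), of 0]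
      by simp
    then show ?thesis by (metis row_mat_of_row)
  qed
  moreover have "u \<in> principal_component (n + 1)"
    using red by (simp add: exp_reduces_def principal_component_def)
  ultimately show ?thesis
    using W invertible_mat_det_1[OF W(1,2)] by blast
qed

end
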